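(* Let $S$ be a numerical semigroup with void $M(S)$, and let $I\subseteq M(S)$. Then $S\subseteq A(I\cup S)$ if and only if $I$ is an order ideal of the void poset $(M(S),\preccurlyeq)$.
   Context: A numerical set $T$ is a subset of $\mathbb{N}_0=\{0,1,2,\dots\}$ containing $0$ with finite complement; elements of $\mathbb{N}_0\setminus T$ are its gaps, and its Frobenius number $F(T)$ is the largest gap (defined when $T\ne\mathbb{N}_0$, so here $S\neq\mathbb{N}_0$). A numerical semigroup is a numerical set closed under addition. The atom monoid of $T$ is $A(T)=\{x\in\mathbb{N}_0 \mid x+T\subseteq T\}$. The void of $S$ is the set $M(S)$ of gaps $a$ of $S$ such that $F(S)-a$ is also a gap of $S$, partially ordered by $x\preccurlyeq y$ iff $y-x\in S$; this is the void poset. A subset $I\subseteq M(S)$ is an order ideal if $x\in I$, $y\in M(S)$, $x\preccurlyeq y$ imply $y\in I$ (upward closed). *)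

theory Defs
  imports Main
begin

definition numerical_set :: "nat set \<Rightarrow> bool" where
  "numerical_set T \<longleftrightarrow> 0 \<in> T \<and> finite (- T)"

definition gaps :: "nat set \<Rightarrow> nat set" where
  "gaps T = - T"

(* Meaningful only for a numerical set T with T \<noteq> UNIV: Max {} is unspecified. *)
definition frobenius :: "nat set \<Rightarrow> nat" where
  "frobenius T = Max (gaps T)"

definition numerical_semigroup :: "nat set \<Rightarrow> bool" where
  "numerical_semigroup S \<longleftrightarrow> numerical_set S \<and> (\<forall>x\<in>S. \<forall>y\<in>S. x + y \<in> S)"

definition atom_monoid :: "nat set \<Rightarrow> nat set" where
  "atom_monoid T = {x. (+) x ` T \<subseteq> T}"

(* The subtraction is never truncated, since gaps do not exceed the Frobenius number
   (lemma gap_le_frobenius). *)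
definition void :: "nat set \<Rightarrow> nat set" where
  "void S = {a \<in> gaps S. frobenius S - a \<in> gaps S}"

(* The conjunct x \<le> y makes y - x the integer difference: truncated subtraction would give
   0 \<in> S whenever y < x. *)
definition void_le :: "nat set \<Rightarrow> nat \<Rightarrow> nat \<Rightarrow> bool" where
  "void_le S x y \<longleftrightarrow> x \<le> y \<and> y - x \<in> S"

definition void_order_ideal :: "nat set \<Rightarrow> nat set \<Rightarrow> bool" where
  "void_order_ideal S I \<longleftrightarrow>
     I \<subseteq> void S \<and> (\<forall>x y. x \<in> I \<longrightarrow> y \<in> void S \<longrightarrow> void_le S x y \<longrightarrow> y \<in> I)"

lemma gap_le_frobenius:
  assumes "numerical_set T" and "a \<in> gaps T"
  shows "a \<le> frobenius T"
  using assms by (simp add: numerical_set_def frobenius_def gaps_def)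

lemma partial_order_on_void:
  assumes "numerical_semigroup S"
  shows "partial_order_on (void S) {(x, y) \<in> void S \<times> void S. void_le S x y}"
proof -
  have "void_le S x z" if "void_le S x y" "void_le S y z" for x y z
  proof -
    have "z - x = (y - x) + (z - y)"
      using that by (simp add: void_le_def)
    moreover have "(y - x) + (z - y) \<in> S"
      using that assms unfolding void_le_def numerical_semigroup_def by blast
    ultimately show ?thesis
      using that unfolding void_le_def by (metis le_trans)
  qed
  moreover have "void_le S x x" for x
    using assms by (simp add: void_le_def numerical_semigroup_def numerical_set_def)
  moreover have "x = y" if "void_le S x y" "void_le S y x" for x y
    using that by (simp add: void_le_def)
  ultimately show ?thesis
    unfolding partial_order_on_def preorder_on_def refl_on_def trans_def antisym_def
    by blast
qed

end

theory Submission
  imports Defs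
begin

text \<open>The inclusion \<open>S \<subseteq> atom_monoid (I \<union> S)\<close> means that
  translation by elements of \<open>S\<close> maps \<open>I \<union> S\<close> into itself. On
  \<open>S\<close> this is closure under addition, so only sums \<open>s + x\<close> with
  \<open>x \<in> I\<close> matter, and these are exactly the numbers lying above \<open>x\<close>
  for \<open>void_le S\<close>. Upward closure only speaks of sums inside the void; by
  \<open>void_add\<close>, every other sum already lies in \<open>S\<close>.\<close>

lemma void_add:
  assumes S: "numerical_semigroup S" and s: "s \<in> S" and t: "t \<in> void S"
    and gap: "s + t \<in> gaps S"
  shows "s + t \<in> void S"
proof -
  \<comment> \<open>This bound keeps the subtraction of \<open>s + t\<close> from being
    truncated.\<close>
  have "s + t \<le> frobenius S"
    using gap_le_frobenius S gap by (simp add: numerical_semigroup_def)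
  then have eq: "s + (frobenius S - (s + t)) = frobenius S - t"
    by simp
  have "frobenius S - t \<notin> S"
    using t by (simp add: void_def gaps_def)
  \<comment> \<open>Otherwise adding \<open>s\<close> would put \<open>frobenius S - t\<close> into
    \<open>S\<close>.\<close>
  then have "frobenius S - (s + t) \<notin> S"
    using S s eq unfolding numerical_semigroup_def by metis
  then show ?thesis
    using gap by (simp add: void_def gaps_def)
qed

theorem proposition2p4:
  fixes S I :: "nat set"
  assumes "numerical_semigroup S"
    and "S \<noteq> UNIV"
    and "I \<subseteq> void S"
  shows "S \<subseteq> atom_monoid (I \<union> S) \<longleftrightarrow> void_order_ideal S I"
proof
  assume sub: "S \<subseteq> atom_monoid (I \<union> S)"
  have "y \<in> I" if "x \<in> I" "y \<in> void S" "void_le S x y" for x y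
  proof -
    have "(y - x) + x \<in> I \<union> S"
      using sub that unfolding atom_monoid_def void_le_def by blast
    \<comment> \<open>The sum is \<open>y\<close>, which is a gap and so can only lie in
      \<open>I\<close>.\<close>
    then show ?thesis
      using that by (simp add: void_le_def void_def gaps_def)
  qed
  then show "void_order_ideal S I"
    using assms(3) by (auto simp: void_order_ideal_def)
next
  assume ideal: "void_order_ideal S I"
  have "s + t \<in> I \<union> S" if "s \<in> S" "t \<in> I \<union> S" for s t
  \<comment> \<open>What remains is \<open>t \<in> I\<close> with \<open>s + t\<close> a gap:
    \<open>void_add\<close> puts the sum in the void, above \<open>t\<close>.\<close>
  proof (cases "t \<in> S \<or> s + t \<in> S")
    case True
    then show ?thesis
      using assms(1) that by (auto simp: numerical_semigroup_def)
  next
    case False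
    then have "t \<in> I" "s + t \<in> void S"
      using that assms void_add[of S s t] by (auto simp: gaps_def)
    moreover have "void_le S t (s + t)"
      using that by (simp add: void_le_def)
    ultimately show ?thesis
      using ideal unfolding void_order_ideal_def by blast
  qed
  then show "S \<subseteq> atom_monoid (I \<union> S)"
    by (auto simp: atom_monoid_def)
qed

end
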